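(* Let $X$ be a real normed linear space, $\Omega\subseteq X$ a nonempty closed set, $v\in X$ nonzero, and $T(x):=\inf\{t\ge 0\mid x+tv\in\Omega\}$. For any $\bar x\in\Omega$, $$\partial T(\bar x)=\{x^*\in X^*\mid\langle x^*,-v\rangle\le1\}\cap N(\bar x;\Omega),$$ where $\partial$ and $N$ denote the limiting (Mordukhovich) subdifferential and normal cone.
   Context: $T$ takes values in $[0,\infty]$ with $\inf\emptyset=\infty$; $X^*$ is the topological dual of $X$. The Fréchet normal cone $\widehat N(y;\Omega)$ at $y\in\Omega$ is the set of $x^*\in X^*$ such that for every $\varepsilon>0$ there is $\delta>0$ with $\langle x^*,x-y\rangle\le\varepsilon\|x-y\|$ for all $x\in\Omega$ with $\|x-y\|\le\delta$. The limiting normal cone $N(\bar x;\Omega)$ is the set of $x^*\in X^*$ for which there are sequences $x_k\to\bar x$ with $x_k\in\Omega$, and $x_k^*\in\widehat N(x_k;\Omega)$ with $x_k^*\to x^*$ in the weak$^*$ topology. For $\psi:X\to(-\infty,\infty]$ and $\psi(\bar x)<\infty$, the Fréchet subdifferential $\widehat\partial\psi(\bar x)$ is the set of $x^*\in X^*$ such that for every $\varepsilon>0$ there is $\delta>0$ with $\langle x^*,x-\bar x\rangle\le\psi(x)-\psi(\bar x)+\varepsilon\|x-\bar x\|$ whenever $\|x-\bar x\|\le\delta$. The limiting subdifferential $\partial\psi(\bar x)$ is the set of $x^*\in X^*$ for which there are sequences $x_k\to\bar x$ with $\psi(x_k)\to\psi(\bar x)$, and $x_k^*\in\widehat\partial\psi(x_k)$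 with $x_k^*\to x^*$ weak$^*$. *)

theory Defs
  imports "HOL-Analysis.Analysis"
begin

text \<open>
  The topological dual of a real normed space \<open>'a\<close> is the type \<open>'a \<Rightarrow>\<^sub>L real\<close>. On it, the library's
  strong operator topology is the topology of pointwise convergence, that is, the weak* topology.
\<close>

abbreviation weak_star_topology :: "('a::real_normed_vector \<Rightarrow>\<^sub>L real) topology" where
  "weak_star_topology \<equiv> strong_operator_topology"

text \<open>The infimum is taken in \<^typ>\<open>ereal\<close>, so it is \<open>\<infinity>\<close> when no admissible \<open>t\<close> exists.\<close>

definition directional_min_time :: "'a::real_normed_vector set \<Rightarrow> 'a \<Rightarrow> 'a \<Rightarrow> ereal" where
  "directional_min_time \<Omega> v x = Inf (ereal ` {t. 0 \<le> t \<and> x + t *\<^sub>R v \<in> \<Omega>})"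

text \<open>The normal cones are only meaningful at points of \<open>\<Omega>\<close>.\<close>

definition frechet_normal_cone ::
    "'a::real_normed_vector \<Rightarrow> 'a set \<Rightarrow> ('a \<Rightarrow>\<^sub>L real) set" where
  "frechet_normal_cone y \<Omega> =
     {x'. \<forall>\<epsilon>>0. \<exists>\<delta>>0. \<forall>x\<in>\<Omega>. norm (x - y) \<le> \<delta> \<longrightarrow>
        blinfun_apply x' (x - y) \<le> \<epsilon> * norm (x - y)}"

definition limiting_normal_cone ::
    "'a::real_normed_vector \<Rightarrow> 'a set \<Rightarrow> ('a \<Rightarrow>\<^sub>L real) set" where
  "limiting_normal_cone xbar \<Omega> =
     {x'. \<exists>(x :: nat \<Rightarrow> 'a) (xs :: nat \<Rightarrow> 'a \<Rightarrow>\<^sub>L real).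
        (\<forall>k. x k \<in> \<Omega>) \<and> x \<longlonglongrightarrow> xbar \<and>
        (\<forall>k. xs k \<in> frechet_normal_cone (x k) \<Omega>) \<and>
        limitin weak_star_topology xs x' sequentially}"

text \<open>
  The subdifferentials are defined at points where \<open>\<psi>\<close> is finite; elsewhere they are empty.
\<close>

definition frechet_subdifferential ::
    "('a::real_normed_vector \<Rightarrow> ereal) \<Rightarrow> 'a \<Rightarrow> ('a \<Rightarrow>\<^sub>L real) set" where
  "frechet_subdifferential \<psi> xbar =
     {x'. \<bar>\<psi> xbar\<bar> \<noteq> \<infinity> \<and>
        (\<forall>\<epsilon>>0. \<exists>\<delta>>0. \<forall>x. norm (x - xbar) \<le> \<delta> \<longrightarrow>
           ereal (blinfun_apply x' (x - xbar)) \<le> \<psi> x - \<psi> xbar + ereal (\<epsilon> * norm (x - xbar)))}"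

definition limiting_subdifferential ::
    "('a::real_normed_vector \<Rightarrow> ereal) \<Rightarrow> 'a \<Rightarrow> ('a \<Rightarrow>\<^sub>L real) set" where
  "limiting_subdifferential \<psi> xbar =
     {x'. \<bar>\<psi> xbar\<bar> \<noteq> \<infinity> \<and>
        (\<exists>(x :: nat \<Rightarrow> 'a) (xs :: nat \<Rightarrow> 'a \<Rightarrow>\<^sub>L real).
           x \<longlonglongrightarrow> xbar \<and> (\<lambda>k. \<psi> (x k)) \<longlonglongrightarrow> \<psi> xbar \<and>
           (\<forall>k. xs k \<in> frechet_subdifferential \<psi> (x k)) \<and>
           limitin weak_star_topology xs x' sequentially)}"

end

theory Submission
  imports Defs
begin

text \<open>
  Closedness of \<open>\<Omega>\<close> makes the infimum in \<open>T(x)\<close> attained, so \<open>x\<close> with \<open>T(x) < \<infinity>\<close> has the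
  projection \<open>w = x + T(x)v \<in> \<Omega>\<close> along \<open>v\<close>. Since \<open>T(u - T(x)v) \<le> T(x)\<close> for \<open>u \<in> \<Omega>\<close> and
  \<open>T(x - sv) \<le> T(x) + s\<close>, every Frechet subgradient of \<open>T\<close> at \<open>x\<close> is a Frechet normal at \<open>w\<close>
  whose value at \<open>-v\<close> is at most \<open>1\<close>; on \<open>\<Omega>\<close> itself the converse holds too. When passing to the
  limit, the normals \<open>x\<^sub>k\<^sup>*\<close> approximating \<open>x\<^sup>*\<close> may violate the bound at \<open>-v\<close>; dividing them by
  \<open>max 1 \<langle>x\<^sub>k\<^sup>*, -v\<rangle> \<longlonglongrightarrow> 1\<close> repairs this, because the normals form a cone.
\<close>

text \<open>The strong operator topology is the pullback of the product topology on functions along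
  \<open>blinfun_apply\<close>, and limits in a product topology are componentwise. This lets weak*
  limits be handled by evaluating at single vectors.\<close>

lemma limitin_strong_operator_topology_iff:
  "limitin strong_operator_topology f l F \<longleftrightarrow>
    (\<forall>x. ((\<lambda>k. blinfun_apply (f k) x) \<longlongrightarrow> blinfun_apply l x) F)"
proof
  assume lim: "limitin strong_operator_topology f l F"
  show "\<forall>x. ((\<lambda>k. blinfun_apply (f k) x) \<longlongrightarrow> blinfun_apply l x) F"
  proof
    fix x
    show "((\<lambda>k. blinfun_apply (f k) x) \<longlongrightarrow> blinfun_apply l x) F"
      using continuous_map_limit[OF strong_operator_topology_continuous_evaluation[of x] lim]
      by (simp add: comp_def)
  qed
next
  assume *: "\<forall>x. ((\<lambda>k. blinfun_apply (f k) x) \<longlongrightarrow> blinfun_apply l x) F"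
  have fun_lim: "limitin euclidean (\<lambda>k. blinfun_apply (f k)) (blinfun_apply l) F"
    unfolding euclidean_product_topology[symmetric] limitin_componentwise using * by simp
  show "limitin strong_operator_topology f l F"
    unfolding limitin_def
  proof (intro conjI allI impI)
    show "l \<in> topspace strong_operator_topology"
      by (simp add: strong_operator_topology_topspace)
    fix U assume U: "openin strong_operator_topology U \<and> l \<in> U"
    then obtain V where V: "open V" "U = blinfun_apply -` V"
      by (auto simp: strong_operator_topology_def openin_pullback_topology)
    then show "\<forall>\<^sub>F k in F. f k \<in> U"
      using limitinD[OF fun_lim, of V] U by auto
  qed
qed

lemma directional_min_time_nonneg: "0 \<le> directional_min_time \<Omega> v x"
  unfolding directional_min_time_def by (rule Inf_greatest) auto

lemma directional_min_time_le:
  assumes "0 \<le> t" "x + t *\<^sub>R v \<in> \<Omega>"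
  shows "directional_min_time \<Omega> v x \<le> ereal t"
  unfolding directional_min_time_def using assms by (intro Inf_lower) auto

lemma directional_min_time_eq_0:
  assumes "x \<in> \<Omega>"
  shows "directional_min_time \<Omega> v x = 0"
  using directional_min_time_le[of 0 x v \<Omega>] directional_min_time_nonneg[of \<Omega> v x] assms
  by (simp add: antisym zero_ereal_def)

text \<open>The admissible times are the part in \<open>{0..}\<close> of the preimage of \<Omega>
  under the continuous map \<open>t \<mapsto> x + t v\<close>. This set is closed and bounded below,
  so when nonempty it contains its infimum.\<close>

lemma directional_min_time_attained:
  assumes "closed \<Omega>" and finite: "directional_min_time \<Omega> v x \<noteq> \<infinity>"
  obtains t where "0 \<le> t" "directional_min_time \<Omega> v x = ereal t" "x + t *\<^sub>R v \<in> \<Omega>"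
proof -
  define S where "S = {t. 0 \<le> t \<and> x + t *\<^sub>R v \<in> \<Omega>}"
  have T: "directional_min_time \<Omega> v x = Inf (ereal ` S)"
    by (simp add: directional_min_time_def S_def)
  have ne: "S \<noteq> {}"
    using finite by (auto simp: T top_ereal_def)
  have bdd: "bdd_below S"
    unfolding S_def by (rule bdd_belowI[of _ 0]) auto
  have "S = {0..} \<inter> (\<lambda>t. x + t *\<^sub>R v) -` \<Omega>"
    by (auto simp: S_def)
  then have "closed S"
    using assms(1) by (auto intro!: closed_Int closed_vimage continuous_intros)
  then have "Inf S \<in> S"
    using closed_contains_Inf[OF ne bdd] by blast
  moreover have "directional_min_time \<Omega> v x = ereal (Inf S)"
    unfolding T using ereal_Inf'[OF bdd ne] by simp
  ultimately show thesis
    using that unfolding S_def by blast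
qed

lemma frechet_subgradient_directional_min_time:
  assumes "closed \<Omega>" and sub: "x' \<in> frechet_subdifferential (directional_min_time \<Omega> v) x"
  obtains t where "0 \<le> t" "directional_min_time \<Omega> v x = ereal t" "x + t *\<^sub>R v \<in> \<Omega>"
    "x' \<in> frechet_normal_cone (x + t *\<^sub>R v) \<Omega>" "blinfun_apply x' (- v) \<le> 1"
proof -
  let ?T = "directional_min_time \<Omega> v"
  have "?T x \<noteq> \<infinity>"
    using sub by (auto simp: frechet_subdifferential_def)
  with assms(1) obtain t where t: "0 \<le> t" "?T x = ereal t" "x + t *\<^sub>R v \<in> \<Omega>"
    by (rule directional_min_time_attained)
  \<comment> \<open>Replacing \<open>?T y\<close> by an arbitrary admissible time \<open>s\<close>
    turns the subgradient inequality into a purely real one. Both conclusions follow from it by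
    choosing the pair \<open>(y, s)\<close>.\<close>
  have subgradient: "\<exists>\<delta>>0. \<forall>y s. norm (y - x) \<le> \<delta> \<longrightarrow> 0 \<le> s \<longrightarrow> y + s *\<^sub>R v \<in> \<Omega> \<longrightarrow>
      blinfun_apply x' (y - x) \<le> s - t + \<epsilon> * norm (y - x)" if eps: "\<epsilon> > 0" for \<epsilon>
  proof -
    obtain \<delta> where "\<delta> > 0" and \<delta>: "\<And>y. norm (y - x) \<le> \<delta> \<Longrightarrow>
        ereal (blinfun_apply x' (y - x)) \<le> ?T y - ?T x + ereal (\<epsilon> * norm (y - x))"
      using sub eps unfolding frechet_subdifferential_def by blast
    have "blinfun_apply x' (y - x) \<le> s - t + \<epsilon> * norm (y - x)"
      if "norm (y - x) \<le> \<delta>" "0 \<le> s" "y + s *\<^sub>R v \<in> \<Omega>" for y s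
    proof -
      have "ereal (blinfun_apply x' (y - x)) \<le> ereal s - ereal t + ereal (\<epsilon> * norm (y - x))"
        using \<delta>[OF that(1)] directional_min_time_le[OF that(2,3)] unfolding t(2)
        by (meson add_right_mono ereal_minus_mono order_refl order_trans)
      then show ?thesis
        by simp
    qed
    with \<open>\<delta> > 0\<close> show ?thesis
      by blast
  qed
  have "x' \<in> frechet_normal_cone (x + t *\<^sub>R v) \<Omega>"
    unfolding frechet_normal_cone_def
  proof (intro CollectI allI impI)
    fix \<epsilon> :: real assume "\<epsilon> > 0"
    then obtain \<delta> where "\<delta> > 0" and \<delta>: "\<And>y s. norm (y - x) \<le> \<delta> \<Longrightarrow> 0 \<le> s \<Longrightarrow>
        y + s *\<^sub>R v \<in> \<Omega> \<Longrightarrow> blinfun_apply x' (y - x) \<le> s - t + \<epsilon> * norm (y - x)"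
      using subgradient by meson
    \<comment> \<open>The test point \<open>w - t v\<close> reaches \<open>w\<close> in time
      \<open>t\<close>, so the term \<open>s - t\<close> vanishes.\<close>
    have "blinfun_apply x' (w - (x + t *\<^sub>R v)) \<le> \<epsilon> * norm (w - (x + t *\<^sub>R v))"
      if "w \<in> \<Omega>" "norm (w - (x + t *\<^sub>R v)) \<le> \<delta>" for w
      using \<delta>[of "w - t *\<^sub>R v" t] that t(1) by (simp add: algebra_simps)
    with \<open>\<delta> > 0\<close> show "\<exists>\<delta>>0. \<forall>w\<in>\<Omega>. norm (w - (x + t *\<^sub>R v)) \<le> \<delta> \<longrightarrow>
        blinfun_apply x' (w - (x + t *\<^sub>R v)) \<le> \<epsilon> * norm (w - (x + t *\<^sub>R v))"
      by blast
  qed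
  moreover have "blinfun_apply x' (- v) \<le> 1"
  proof (rule field_le_epsilon)
    fix e :: real assume "e > 0"
    \<comment> \<open>The summand 1 keeps the divisor positive, and the slack \<open>e / n\<close>
      then contributes at most \<open>e\<close> after multiplication by
      \<open>norm v\<close>.\<close>
    define n where "n = norm v + 1"
    have n: "n > 0" "norm v \<le> n"
      by (auto simp: n_def add_nonneg_pos)
    then have "e / n > 0"
      using \<open>e > 0\<close> by simp
    then obtain \<delta> where "\<delta> > 0" and \<delta>: "\<And>y s. norm (y - x) \<le> \<delta> \<Longrightarrow> 0 \<le> s \<Longrightarrow>
        y + s *\<^sub>R v \<in> \<Omega> \<Longrightarrow> blinfun_apply x' (y - x) \<le> s - t + e / n * norm (y - x)"
      using subgradient by meson
    define s where "s = \<delta> / n"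
    have s: "s > 0" "s * norm v \<le> \<delta>"
      using \<open>\<delta> > 0\<close> n by (auto simp: s_def field_simps)
    \<comment> \<open>Moving back from \<open>x\<close> by \<open>s v\<close> reaches the same
      projection in time \<open>t + s\<close>; dividing by \<open>s\<close> leaves a bound at
      \<open>- v\<close>.\<close>
    have "blinfun_apply x' (x - s *\<^sub>R v - x)
        \<le> (t + s) - t + e / n * norm (x - s *\<^sub>R v - x)"
      using s t by (intro \<delta>) (auto simp: algebra_simps)
    then have "s * blinfun_apply x' (- v) \<le> s * (1 + e / n * norm v)"
      using s(1) by (simp add: blinfun.scaleR_right blinfun.minus_right algebra_simps)
    then have "blinfun_apply x' (- v) \<le> 1 + e / n * norm v"
      using s(1) by simp
    also have "e / n * norm v \<le> e"
      using n \<open>e > 0\<close> by (simp add: field_simps)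
    finally show "blinfun_apply x' (- v) \<le> 1 + e"
      by simp
  qed
  ultimately show thesis
    using that t by blast
qed

text \<open>If \<open>T x\<close> exceeds \<open>C * norm (x - y)\<close>, the operator norm bound
  alone suffices. Otherwise the projection \<open>w\<close> of \<open>x\<close> along
  \<open>v\<close> is close to \<open>y\<close>, and the normal inequality applies to it.\<close>

lemma frechet_normal_imp_subgradient:
  assumes "closed \<Omega>" "y \<in> \<Omega>" and normal: "x' \<in> frechet_normal_cone y \<Omega>"
    and le1: "blinfun_apply x' (- v) \<le> 1"
  shows "x' \<in> frechet_subdifferential (directional_min_time \<Omega> v) y"
proof -
  let ?T = "directional_min_time \<Omega> v"
  have Ty: "?T y = 0"
    using assms(2) by (rule directional_min_time_eq_0)
  define C where "C = norm x'"
  \<comment> \<open>In the second case \<open>norm (w - y)\<close> is at most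
    \<open>K * norm (x - y)\<close>, so both the tolerance and the radius are divided by
    \<open>K\<close>.\<close>
  define K where "K = 1 + C * norm v"
  have C: "0 \<le> C" "blinfun_apply x' u \<le> C * norm u" for u
    using norm_blinfun[of x' u] by (auto simp: C_def)
  then have K: "K > 0"
    by (simp add: K_def add_pos_nonneg)
  have "\<exists>\<delta>>0. \<forall>x. norm (x - y) \<le> \<delta> \<longrightarrow>
      ereal (blinfun_apply x' (x - y)) \<le> ?T x - ?T y + ereal (\<epsilon> * norm (x - y))"
    if "\<epsilon> > 0" for \<epsilon>
  proof -
    have "\<epsilon> / K > 0"
      using that K by simp
    then obtain \<delta> where "\<delta> > 0" and \<delta>: "\<And>w. w \<in> \<Omega> \<Longrightarrow> norm (w - y) \<le> \<delta> \<Longrightarrow>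
        blinfun_apply x' (w - y) \<le> \<epsilon> / K * norm (w - y)"
      using normal unfolding frechet_normal_cone_def by blast
    have "ereal (blinfun_apply x' (x - y)) \<le> ?T x + ereal (\<epsilon> * norm (x - y))"
      if x: "norm (x - y) \<le> \<delta> / K" for x
    proof (cases "?T x \<le> ereal (C * norm (x - y))")
      \<comment> \<open>This case includes \<open>?T x = \<infinity>\<close>, so a projection need
        not exist here.\<close>
      case False
      have "ereal (blinfun_apply x' (x - y)) \<le> ereal (C * norm (x - y))"
        using C by simp
      also have "\<dots> \<le> ?T x + 0"
        using False by simp
      also have "\<dots> \<le> ?T x + ereal (\<epsilon> * norm (x - y))"
        using \<open>\<epsilon> > 0\<close> by (intro add_left_mono) simp
      finally show ?thesis .
    next
      case True
      then have "?T x \<noteq> \<infinity>"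
        by auto
      with assms(1) obtain t where t: "0 \<le> t" "?T x = ereal t" "x + t *\<^sub>R v \<in> \<Omega>"
        by (rule directional_min_time_attained)
      define w where "w = x + t *\<^sub>R v"
      have tC: "t \<le> C * norm (x - y)"
        using True t by simp
      have "norm (w - y) = norm ((x - y) + t *\<^sub>R v)"
        by (simp add: w_def algebra_simps)
      also have "\<dots> \<le> norm (x - y) + t * norm v"
        using norm_triangle_ineq[of "x - y" "t *\<^sub>R v"] t(1) by simp
      also have "\<dots> \<le> norm (x - y) + C * norm (x - y) * norm v"
        using tC by (intro add_left_mono mult_right_mono) auto
      finally have w: "norm (w - y) \<le> K * norm (x - y)"
        by (simp add: K_def algebra_simps)
      also have "\<dots> \<le> \<delta>"
        using x K by (simp add: field_simps)
      finally have "blinfun_apply x' (w - y) \<le> \<epsilon> / K * norm (w - y)"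
        using \<delta> t(3) by (simp add: w_def)
      also have "\<dots> \<le> \<epsilon> / K * (K * norm (x - y))"
        using w \<open>\<epsilon> / K > 0\<close> by (intro mult_left_mono) auto
      finally have 1: "blinfun_apply x' (w - y) \<le> \<epsilon> * norm (x - y)"
        using K by simp
      \<comment> \<open>The first summand is controlled by normality, the second by
        \<open>t\<close>, which is exactly \<open>?T x\<close>.\<close>
      have "blinfun_apply x' (x - y) = blinfun_apply x' (w - y) + t * blinfun_apply x' (- v)"
        by (simp add: w_def blinfun.bilinear_simps)
      also have "t * blinfun_apply x' (- v) \<le> t"
        using le1 t(1) mult_left_mono by fastforce
      finally show ?thesis
        using 1 t(2) by simp
    qed
    moreover have "\<delta> / K > 0"
      using \<open>\<delta> > 0\<close> K by simp
    ultimately show ?thesis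
      unfolding Ty by (metis ereal_minus(7))
  qed
  then show ?thesis
    unfolding frechet_subdifferential_def by (simp add: Ty)
qed

text \<open>The tolerance \<open>\<epsilon> / c\<close> for \<open>x'\<close> yields the tolerance
  \<epsilon> for its multiple by \<open>c\<close>.\<close>

lemma frechet_normal_cone_scaleR:
  assumes "x' \<in> frechet_normal_cone y \<Omega>" "0 < c"
  shows "c *\<^sub>R x' \<in> frechet_normal_cone y \<Omega>"
  unfolding frechet_normal_cone_def
proof (intro CollectI allI impI)
  fix \<epsilon> :: real assume "\<epsilon> > 0"
  then have "\<epsilon> / c > 0"
    using assms(2) by simp
  then obtain \<delta> where "\<delta> > 0" and \<delta>: "\<And>x. x \<in> \<Omega> \<Longrightarrow> norm (x - y) \<le> \<delta> \<Longrightarrow>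
      blinfun_apply x' (x - y) \<le> \<epsilon> / c * norm (x - y)"
    using assms(1) unfolding frechet_normal_cone_def by blast
  then show "\<exists>\<delta>>0. \<forall>x\<in>\<Omega>. norm (x - y) \<le> \<delta> \<longrightarrow>
      blinfun_apply (c *\<^sub>R x') (x - y) \<le> \<epsilon> * norm (x - y)"
    using assms(2) by (intro exI[of _ \<delta>]) (auto simp: blinfun.scaleR_left field_simps)
qed

theorem theorem3p18:
  fixes \<Omega> :: "'a::real_normed_vector set" and v xbar :: 'a
  assumes "\<Omega> \<noteq> {}" and "closed \<Omega>" and "v \<noteq> 0" and "xbar \<in> \<Omega>"
  shows "limiting_subdifferential (directional_min_time \<Omega> v) xbar =
    {x' :: 'a \<Rightarrow>\<^sub>L real. blinfun_apply x' (- v) \<le> 1} \<inter> limiting_normal_cone xbar \<Omega>"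
proof (intro equalityI subsetI)
  let ?T = "directional_min_time \<Omega> v"
  have T_xbar: "?T xbar = 0"
    using assms(4) by (rule directional_min_time_eq_0)
  {
    fix x' assume "x' \<in> limiting_subdifferential ?T xbar"
    then obtain x xs where x: "x \<longlonglongrightarrow> xbar" and Tx: "(\<lambda>k. ?T (x k)) \<longlonglongrightarrow> 0"
      and xs: "\<And>k. xs k \<in> frechet_subdifferential ?T (x k)"
      and lim: "limitin weak_star_topology xs x' sequentially"
      unfolding limiting_subdifferential_def T_xbar by blast
    have "\<forall>k. \<exists>t. ?T (x k) = ereal t \<and> x k + t *\<^sub>R v \<in> \<Omega> \<and>
        xs k \<in> frechet_normal_cone (x k + t *\<^sub>R v) \<Omega> \<and> blinfun_apply (xs k) (- v) \<le> 1"
      using frechet_subgradient_directional_min_time[OF assms(2) xs] by metis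
    then obtain t where t: "\<And>k. ?T (x k) = ereal (t k)" "\<And>k. x k + t k *\<^sub>R v \<in> \<Omega>"
      "\<And>k. xs k \<in> frechet_normal_cone (x k + t k *\<^sub>R v) \<Omega>"
      "\<And>k. blinfun_apply (xs k) (- v) \<le> 1"
      by metis
    \<comment> \<open>The convergence of the values of \<open>?T\<close> to
      \<open>?T xbar = 0\<close> is what makes the projections converge to
      \<open>xbar\<close>.\<close>
    have "t \<longlonglongrightarrow> 0"
      using Tx by (simp add: t(1) zero_ereal_def)
    then have "(\<lambda>k. x k + t k *\<^sub>R v) \<longlonglongrightarrow> xbar + 0 *\<^sub>R v"
      by (intro tendsto_intros x)
    then have "x' \<in> limiting_normal_cone xbar \<Omega>"
      unfolding limiting_normal_cone_def using t(2,3) lim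
      by (intro CollectI exI[of _ "\<lambda>k. x k + t k *\<^sub>R v"] exI[of _ xs]) simp
    moreover have "blinfun_apply x' (- v) \<le> 1"
      using lim t(4) unfolding limitin_strong_operator_topology_iff
      by (blast intro: LIMSEQ_le_const2)
    ultimately show "x' \<in> {x'. blinfun_apply x' (- v) \<le> 1} \<inter> limiting_normal_cone xbar \<Omega>"
      by simp
  next
    fix x' assume "x' \<in> {x'. blinfun_apply x' (- v) \<le> 1} \<inter> limiting_normal_cone xbar \<Omega>"
    then obtain x xs where le1: "blinfun_apply x' (- v) \<le> 1" and x: "\<And>k. x k \<in> \<Omega>" "x \<longlonglongrightarrow> xbar"
      and xs: "\<And>k. xs k \<in> frechet_normal_cone (x k) \<Omega>"
      and lim: "\<And>u. (\<lambda>k. blinfun_apply (xs k) u) \<longlonglongrightarrow> blinfun_apply x' u"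
      unfolding limiting_normal_cone_def limitin_strong_operator_topology_iff by blast
    define m where "m k = max 1 (blinfun_apply (xs k) (- v))" for k
    have m: "m k \<ge> 1" "blinfun_apply (xs k) (- v) \<le> m k" for k
      by (auto simp: m_def)
    have m_pos: "m k > 0" for k
      using m(1)[of k] by linarith
    \<comment> \<open>Weak* convergence evaluated at \<open>- v\<close> gives this limit, and the
      bound \<open>le1\<close> makes it equal to 1, so the rescaling preserves the weak*
      limit.\<close>
    have "m \<longlonglongrightarrow> max 1 (blinfun_apply x' (- v))"
      unfolding m_def by (intro tendsto_intros lim)
    then have "m \<longlonglongrightarrow> 1"
      using le1 by (simp add: max_absorb1)
    then have "(\<lambda>k. inverse (m k) * blinfun_apply (xs k) u) \<longlonglongrightarrow> inverse 1 * blinfun_apply x' u" for u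
      by (intro tendsto_intros lim) auto
    then have lim': "limitin weak_star_topology (\<lambda>k. inverse (m k) *\<^sub>R xs k) x' sequentially"
      by (simp add: limitin_strong_operator_topology_iff blinfun.scaleR_left)
    have "inverse (m k) *\<^sub>R xs k \<in> frechet_subdifferential ?T (x k)" for k
    proof (rule frechet_normal_imp_subgradient[OF assms(2) x(1)])
      show "inverse (m k) *\<^sub>R xs k \<in> frechet_normal_cone (x k) \<Omega>"
        using xs m_pos by (intro frechet_normal_cone_scaleR) auto
      have "inverse (m k) * blinfun_apply (xs k) (- v) \<le> 1"
        using m(2)[of k] m_pos[of k] by (simp add: field_simps)
      then show "blinfun_apply (inverse (m k) *\<^sub>R xs k) (- v) \<le> 1"
        by (simp add: blinfun.scaleR_left)
    qed
    \<comment> \<open>All \<open>x k\<close> lie in \<Omega>, where \<open>?T\<close> vanishes, so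
      this sequence is constantly 0.\<close>
    moreover have "(\<lambda>k. ?T (x k)) \<longlonglongrightarrow> ?T xbar"
      by (simp add: directional_min_time_eq_0 x(1) T_xbar)
    ultimately show "x' \<in> limiting_subdifferential ?T xbar"
      unfolding limiting_subdifferential_def using x(2) lim' T_xbar
      by (intro CollectI conjI exI[of _ x] exI[of _ "\<lambda>k. inverse (m k) *\<^sub>R xs k"]) auto
  }
qed

end
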